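(* Let $B$ be a nucleation process and $G$ a growth process on $[t_0,T]$, let $t\in[t_0,T]$ and let $\Pi=(t_i)_{i=0}^n$ be a partition of $[t_0,t]$. Then $s_\Pi(t)\subseteq S_\Pi(t)$ almost surely.
   Context: Setting. $\mathfrak X$ is a reflexive Banach space with separable dual; $[t_0,T]\subset\mathbb R$; $(\Omega,\mathfrak F,\{\mathfrak F_t\}_{t\in[t_0,T]},\mathbb P)$ is a filtered complete probability space satisfying the usual conditions. $\mathbb F(\mathfrak X)$ is the family of non-empty closed subsets of $\mathfrak X$. A set-valued map $X$ defined on a measurable space $(E,\mathcal E)$ with values in subsets of $\mathfrak X$ is measurable if $\{e: X(e)\cap O\neq\emptyset\}\in\mathcal E$ for every open $O\subseteq\mathfrak X$. Nucleation process: a map $B:\Omega\times[t_0,T]\to\mathbb F(\mathfrak X)$, $B_t=B(\cdot,t)$, such that $B_t$ is $\mathfrak F_t$-measurable for every $t$, and $B_s\subseteq B_t$ whenever $s<t$. Growth process: a map $G:\Omega\times[t_0,T]\to\mathbb F(\mathfrak X)$ such that for all $(\omega,t)$: $0\in G(\omega,t)$, $G(\omega,t)$ is convex, $G(\omega,t)\subseteq K$ for a fixed non-empty closed bounded set $K\subset\mathfrak X$ (independent of $\omega,t$), and $G$ is measurable with respect to the predictable $\sigma$-algebra $\mathcal P$ on $\Omega\times[t_0,T]$, i.e. the $\sigma$-algebra generated by the sets $A\times\{t_0\}$ with $A\in\mathfrak F_{t_0}$ and $A\times(s,t]$ with $A\in\mathfrak F_s$, $(s,t]\subset[t_0,T]$.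 For $a\le b$, $\int_a^b G(\tau)\,d\tau$ is the random set $\omega\mapsto\int_a^bG(\omega,\tau)\,d\tau$, the Aumann integral with respect to Lebesgue measure: $\{\int_a^b g(\tau)\,d\tau: g \text{ Bochner integrable on }[t_0,T],\ g(\tau)\in G(\omega,\tau)\text{ for a.e. }\tau\}$. Minkowski sum: $A+C=\{a+c:a\in A,c\in C\}$ (with $\emptyset+A=\emptyset$), and $A\oplus C=\overline{A+C}$. A partition of $[t_0,t]$ is $\Pi=(t_i)_{i=0}^n$ with $t_0<t_1<\dots<t_n=t$. Put $\Delta B_{t_i}=B_{t_i}\setminus B_{t_{i-1}}^{o}$, where $B^{o}$ is the interior of $B$, and $$s_\Pi(t)=\Big(B_{t_0}\oplus\int_{t_0}^tG(\tau)d\tau\Big)\cup\bigcup_{i=1}^n\Big(\Delta B_{t_i}\oplus\int_{t_i}^tG(\tau)d\tau\Big),$$ $$S_\Pi(t)=\Big(B_{t_0}\oplus\int_{t_0}^tG(\tau)d\tau\Big)\cup\bigcup_{i=1}^n\Big(\Delta B_{t_i}\oplus\int_{t_{i-1}}^tG(\tau)d\tau\Big).$$ *)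

theory Defs
  imports "HOL-Probability.Probability"
begin

definition reflexive_space :: "'a::real_normed_vector itself \<Rightarrow> bool" where
  "reflexive_space (_ :: 'a itself) \<longleftrightarrow>
    (\<forall>\<phi> :: ('a \<Rightarrow>\<^sub>L real) \<Rightarrow>\<^sub>L real. \<exists>x :: 'a. \<forall>f. blinfun_apply \<phi> f = blinfun_apply f x)"

definition separable_dual :: "'a::real_normed_vector itself \<Rightarrow> bool" where
  "separable_dual (_ :: 'a itself) \<longleftrightarrow>
    separable_space (euclidean :: ('a \<Rightarrow>\<^sub>L real) topology)"

text \<open>\<open>F t\<close> is only relevant for \<open>t \<in> {t0..T}\<close>; of each \<open>F t\<close> only the
  \<open>\<sigma>\<close>-algebra matters.\<close>

locale filtered_complete_prob_space = prob_space M + complete_measure M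
  for M :: "'w measure" and F :: "real \<Rightarrow> 'w measure" and t0 T :: real +
  assumes filtration_subalgebra: "\<And>t. t \<in> {t0..T} \<Longrightarrow> subalgebra M (F t)"
    and filtration_mono: "\<And>s t. t0 \<le> s \<Longrightarrow> s \<le> t \<Longrightarrow> t \<le> T \<Longrightarrow> sets (F s) \<subseteq> sets (F t)"
    and filtration_right_continuous:
      "\<And>t. t0 \<le> t \<Longrightarrow> t < T \<Longrightarrow> sets (F t) = (\<Inter>s\<in>{t<..T}. sets (F s))"
    and filtration_null_sets: "null_sets M \<subseteq> sets (F t0)"

definition set_valued_measurable :: "'e measure \<Rightarrow> ('e \<Rightarrow> 'a::topological_space set) \<Rightarrow> bool" where
  "set_valued_measurable N X \<longleftrightarrow> (\<forall>U. open U \<longrightarrow> {e \<in> space N. X e \<inter> U \<noteq> {}} \<in> sets N)"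

definition predictable_sigma ::
  "'w measure \<Rightarrow> (real \<Rightarrow> 'w measure) \<Rightarrow> real \<Rightarrow> real \<Rightarrow> ('w \<times> real) measure" where
  "predictable_sigma M F t0 T =
    sigma (space M \<times> {t0..T})
      ({A \<times> {t0} | A. A \<in> sets (F t0)} \<union>
       {A \<times> {s<..t} | A s t. t0 \<le> s \<and> s < t \<and> t \<le> T \<and> A \<in> sets (F s)})"

definition nucleation_process ::
  "'w measure \<Rightarrow> (real \<Rightarrow> 'w measure) \<Rightarrow> real \<Rightarrow> real \<Rightarrow>
    ('w \<Rightarrow> real \<Rightarrow> 'a::topological_space set) \<Rightarrow> bool" where
  "nucleation_process M F t0 T B \<longleftrightarrow>
    (\<forall>\<omega>\<in>space M. \<forall>t\<in>{t0..T}. closed (B \<omega> t) \<and> B \<omega> t \<noteq> {}) \<and>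
    (\<forall>t\<in>{t0..T}. set_valued_measurable (F t) (\<lambda>\<omega>. B \<omega> t)) \<and>
    (\<forall>\<omega>\<in>space M. \<forall>s\<in>{t0..T}. \<forall>t\<in>{t0..T}. s < t \<longrightarrow> B \<omega> s \<subseteq> B \<omega> t)"

definition growth_process ::
  "'w measure \<Rightarrow> (real \<Rightarrow> 'w measure) \<Rightarrow> real \<Rightarrow> real \<Rightarrow>
    ('w \<Rightarrow> real \<Rightarrow> 'a::real_normed_vector set) \<Rightarrow> bool" where
  "growth_process M F t0 T G \<longleftrightarrow>
    (\<forall>\<omega>\<in>space M. \<forall>t\<in>{t0..T}.
       closed (G \<omega> t) \<and> G \<omega> t \<noteq> {} \<and> 0 \<in> G \<omega> t \<and> convex (G \<omega> t)) \<and>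
    (\<exists>K. K \<noteq> {} \<and> closed K \<and> bounded K \<and>
       (\<forall>\<omega>\<in>space M. \<forall>t\<in>{t0..T}. G \<omega> t \<subseteq> K)) \<and>
    set_valued_measurable (predictable_sigma M F t0 T) (\<lambda>(\<omega>, t). G \<omega> t)"

text \<open>The selections are defined on the whole time interval \<open>{t0..T}\<close>, the integral is taken
  over \<open>{a..b}\<close>. The library's Bochner integral needs a second countable type; for a Banach
  space this is separability, which is automatic when the dual is separable.\<close>

definition aumann_integral ::
  "real \<Rightarrow> real \<Rightarrow> (real \<Rightarrow> 'a set) \<Rightarrow> real \<Rightarrow> real \<Rightarrow> 'a::{banach, second_countable_topology} set"
where
  "aumann_integral t0 T H a b =
    {set_lebesgue_integral lebesgue {a..b} g | g :: real \<Rightarrow> 'a.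
       set_integrable lebesgue {t0..T} g \<and> (AE \<tau> in lebesgue. \<tau> \<in> {t0..T} \<longrightarrow> g \<tau> \<in> H \<tau>)}"

text \<open>On sets, \<open>+\<close> is the elementwise sum of \<^theory>\<open>HOL-Library.Set_Algebras\<close>.\<close>

definition closed_minkowski_sum :: "'a::real_normed_vector set \<Rightarrow> 'a set \<Rightarrow> 'a set"
  (infixl \<open>\<oplus>\<close> 65) where
  "A \<oplus> C = closure (A + C)"

text \<open>The value \<open>n = 0\<close> is allowed; it occurs exactly when \<open>t = t0\<close>.\<close>

definition interval_partition :: "real \<Rightarrow> real \<Rightarrow> nat \<Rightarrow> (nat \<Rightarrow> real) \<Rightarrow> bool" where
  "interval_partition t0 t n \<pi> \<longleftrightarrow> \<pi> 0 = t0 \<and> \<pi> n = t \<and> (\<forall>i<n. \<pi> i < \<pi> (Suc i))"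

definition nucleation_increment ::
  "(real \<Rightarrow> 'a::topological_space set) \<Rightarrow> (nat \<Rightarrow> real) \<Rightarrow> nat \<Rightarrow> 'a set" where
  "nucleation_increment b \<pi> i = b (\<pi> i) - interior (b (\<pi> (i - 1)))"

definition lower_sum ::
  "real \<Rightarrow> real \<Rightarrow> ('w \<Rightarrow> real \<Rightarrow> 'a set) \<Rightarrow> ('w \<Rightarrow> real \<Rightarrow> 'a set) \<Rightarrow>
    nat \<Rightarrow> (nat \<Rightarrow> real) \<Rightarrow> real \<Rightarrow> 'w \<Rightarrow> 'a::{banach, second_countable_topology} set" where
  "lower_sum t0 T B G n \<pi> t \<omega> =
    (B \<omega> t0 \<oplus> aumann_integral t0 T (G \<omega>) t0 t) \<union>
    (\<Union>i\<in>{1..n}. nucleation_increment (B \<omega>) \<pi> i \<oplus> aumann_integral t0 T (G \<omega>) (\<pi> i) t)"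

definition upper_sum ::
  "real \<Rightarrow> real \<Rightarrow> ('w \<Rightarrow> real \<Rightarrow> 'a set) \<Rightarrow> ('w \<Rightarrow> real \<Rightarrow> 'a set) \<Rightarrow>
    nat \<Rightarrow> (nat \<Rightarrow> real) \<Rightarrow> real \<Rightarrow> 'w \<Rightarrow> 'a::{banach, second_countable_topology} set" where
  "upper_sum t0 T B G n \<pi> t \<omega> =
    (B \<omega> t0 \<oplus> aumann_integral t0 T (G \<omega>) t0 t) \<union>
    (\<Union>i\<in>{1..n}. nucleation_increment (B \<omega>) \<pi> i \<oplus> aumann_integral t0 T (G \<omega>) (\<pi> (i - 1)) t)"

end

theory Submission
  imports Defs
begin

text \<open>Since \<open>0 \<in> G\<close>, extending a selection on \<open>[t\<^sub>i, t]\<close> by zero to \<open>[t\<^sub>i\<^sub>-\<^sub>1, t]\<close> gives a selection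
  with the same integral, so the inclusion holds termwise and for every \<open>\<omega>\<close>.\<close>

lemma aumann_integral_mono:
  assumes zero: "\<And>\<tau>. \<tau> \<in> {t0..T} \<Longrightarrow> 0 \<in> H \<tau>"
    and sub: "{a..b} \<subseteq> {c..d}"
  shows "aumann_integral t0 T H a b \<subseteq> aumann_integral t0 T H c d"
proof
  fix x assume "x \<in> aumann_integral t0 T H a b"
  then obtain g where x: "x = set_lebesgue_integral lebesgue {a..b} g"
    and int: "set_integrable lebesgue {t0..T} g"
    and sel: "AE \<tau> in lebesgue. \<tau> \<in> {t0..T} \<longrightarrow> g \<tau> \<in> H \<tau>"
    unfolding aumann_integral_def by blast
  \<comment> \<open>A selection \<open>g\<close> lives on all of \<open>{t0..T}\<close> and may be
    non-zero outside \<open>{a..b}\<close>; cutting it off there keeps the larger interval from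
    adding to the integral.\<close>
  define h where "h \<tau> = indicator {a..b} \<tau> *\<^sub>R g \<tau>" for \<tau>
  have "set_integrable lebesgue {t0..T} h"
    using integrable_mult_indicator[OF _ int[unfolded set_integrable_def], of "{a..b}"]
    by (simp add: set_integrable_def h_def mult.commute)
  \<comment> \<open>Wherever \<open>h\<close> differs from \<open>g\<close> it is 0, which
    \<open>zero\<close> admits, so the null set excepted for \<open>g\<close> serves for
    \<open>h\<close> too.\<close>
  moreover have "AE \<tau> in lebesgue. \<tau> \<in> {t0..T} \<longrightarrow> h \<tau> \<in> H \<tau>"
    using sel zero by (auto simp: h_def indicator_def elim!: eventually_mono)
  \<comment> \<open>The two integrands agree at every point: both are \<open>g\<close> on
    \<open>{a..b}\<close>, by \<open>sub\<close>, and 0 elsewhere.\<close>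
  moreover have "x = set_lebesgue_integral lebesgue {c..d} h"
    unfolding x set_lebesgue_integral_def
    using sub by (intro Bochner_Integration.integral_cong) (auto simp: h_def indicator_def)
  ultimately show "x \<in> aumann_integral t0 T H c d"
    unfolding aumann_integral_def by blast
qed

lemma closed_minkowski_sum_mono:
  "A \<subseteq> A' \<Longrightarrow> C \<subseteq> C' \<Longrightarrow> A \<oplus> C \<subseteq> A' \<oplus> C'"
  unfolding closed_minkowski_sum_def by (intro closure_mono set_plus_mono2)

theorem proposition4p3:
  fixes M :: "'w measure" and F :: "real \<Rightarrow> 'w measure" and t0 T t :: real
    and B G :: "'w \<Rightarrow> real \<Rightarrow> 'a::{banach, second_countable_topology} set"
    and n :: nat and \<pi> :: "nat \<Rightarrow> real"
  assumes "reflexive_space TYPE('a)"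
    and "separable_dual TYPE('a)"
    and "filtered_complete_prob_space M F t0 T"
    and "nucleation_process M F t0 T B"
    and "growth_process M F t0 T G"
    and "t \<in> {t0..T}"
    and "interval_partition t0 t n \<pi>"
  shows "AE \<omega> in M. lower_sum t0 T B G n \<pi> t \<omega> \<subseteq> upper_sum t0 T B G n \<pi> t \<omega>"
proof (rule AE_I2)
  fix \<omega> assume \<omega>: "\<omega> \<in> space M"
  have zero: "0 \<in> G \<omega> \<tau>" if "\<tau> \<in> {t0..T}" for \<tau>
    using assms(5) \<omega> that unfolding growth_process_def by blast
  \<comment> \<open>Since \<open>i\<close> is at least 1, \<open>i - 1\<close> is its true
    predecessor and an index below \<open>n\<close>.\<close>
  have "\<pi> (i - 1) \<le> \<pi> i" if "i \<in> {1..n}" for i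
    using assms(7) that unfolding interval_partition_def
    by (cases i) (auto intro: less_imp_le)
  \<comment> \<open>Moving the left endpoint back to \<open>\<pi> (i - 1)\<close> enlarges the
    interval of integration, while the increment stays the same.\<close>
  then have "nucleation_increment (B \<omega>) \<pi> i \<oplus> aumann_integral t0 T (G \<omega>) (\<pi> i) t
      \<subseteq> nucleation_increment (B \<omega>) \<pi> i \<oplus> aumann_integral t0 T (G \<omega>) (\<pi> (i - 1)) t"
    if "i \<in> {1..n}" for i
    using that zero by (intro closed_minkowski_sum_mono aumann_integral_mono) auto
  then show "lower_sum t0 T B G n \<pi> t \<omega> \<subseteq> upper_sum t0 T B G n \<pi> t \<omega>"
    unfolding lower_sum_def upper_sum_def by (intro Un_mono UN_mono) auto
qed

end
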